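(* Let $u\in\widetilde{\mathcal V}$ be the solution of $\mathcal L u=0$ with $u(x,0)=u_0(x)$, and let $u_h\in\widetilde{\mathcal V}_h$ be its space-time FOSLS solution (defined in the context), where $\widetilde{\mathcal V}_h$ is a finite-element space of order $p$ and mesh size $h$. Then there is a constant $C$, independent of $h$, such that $$\left|\langle\mathcal L u,u\rangle-\langle\mathcal L u_h,u_h\rangle\right|\le C\,h^p\,\|u\|_{H^{p+1}}.$$
   Context: Let $\widetilde\Omega=\Omega\times[0,T]$ be a space-time domain and $\langle\cdot,\cdot\rangle$ the $L^2(\widetilde\Omega)$ inner product; Sobolev norms are on $\widetilde\Omega$. $\widetilde{\mathcal V}$ is a function space on $\widetilde\Omega$ and $\mathcal L:\widetilde{\mathcal V}\to\widetilde{\mathcal V}$ is a linear operator (incorporating boundary conditions), e.g. one coming from a time-dependent PDE such as $\partial_t-\Delta$ (in a typical FOSLS setting, rewritten as a first-order system with vector-valued $u$). $\widetilde{\mathcal V}_h\subset\widetilde{\mathcal V}$ is a finite-element space on a triangulation of $\widetilde\Omega$, and $V_h$ is a finite-dimensional space on $\Omega$ corresponding to $t=0$; it is assumed that $u_0\in V_h$. $\widetilde{\mathcal V}_o\subset\widetilde{\mathcal V}$ and $\widetilde{\mathcal V}_{h,o}\subset\widetilde{\mathcal V}_h$ are the subspaces of functions with vanishing trace at $t=0$. FOSLS solution: let $\widehat w_h\in\widetilde{\mathcal V}_h$ be an extension of $u_0$, i.e. $\widehat w_h(x,0)=u_0(x)$. Then $u_h=\widehat w_h+\varphi_h$, where $\varphi_h\in\widetilde{\mathcal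 V}_{h,o}$ satisfies $$\langle\mathcal L\varphi_h,\mathcal L v_h\rangle=-\langle\mathcal L\widehat w_h,\mathcal L v_h\rangle\quad\text{for all }v_h\in\widetilde{\mathcal V}_{h,o}.$$ Standing FOSLS setting: the operator is such that the least-squares functional is equivalent to the $H^1$ norm, i.e. $\|\mathcal L v\|_{L^2}\le C\|v\|_{H^1}$ for $v\in\widetilde{\mathcal V}$ and $\|v\|_{H^1}\le C\|\mathcal L v\|_{L^2}$ for $v\in\widetilde{\mathcal V}_o$. The space $\widetilde{\mathcal V}_h$ has approximation order $p$, i.e. $\inf\{\|u-v_h\|_{H^1}:v_h\in\widetilde{\mathcal V}_h,\ v_h(\cdot,0)=u_0\}\le Ch^p\|u\|_{H^{p+1}}$, with $C$ independent of $h$. The solution $u$ is assumed to lie in $H^{p+1}$. *)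

theory Defs
  imports "HOL-Analysis.Analysis" "HOL-Library.Multiset"
begin

section \<open>Square-integrable functions\<close>

text \<open>
  Elements of function spaces are represented by functions; equality in \<open>L\<^sup>2\<close> is equality
  almost everywhere on the domain, and values outside the domain are irrelevant.
\<close>

definition L2 :: "'a::euclidean_space set \<Rightarrow> ('a \<Rightarrow> 'b::euclidean_space) set" where
  "L2 U = {f. f \<in> borel_measurable (lebesgue_on U) \<and>
              integrable (lebesgue_on U) (\<lambda>x. (norm (f x))\<^sup>2)}"

definition L2_inner ::
  "'a::euclidean_space set \<Rightarrow> ('a \<Rightarrow> 'b::euclidean_space) \<Rightarrow> ('a \<Rightarrow> 'b) \<Rightarrow> real" where
  "L2_inner U f g = (LINT x|lebesgue_on U. f x \<bullet> g x)"

definition L2_norm :: "'a::euclidean_space set \<Rightarrow> ('a \<Rightarrow> 'b::euclidean_space) \<Rightarrow> real" where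
  "L2_norm U f = sqrt (L2_inner U f f)"


section \<open>Weak derivatives and Sobolev spaces\<close>

fun iterated_partial ::
  "'a::euclidean_space list \<Rightarrow> ('a \<Rightarrow> real) \<Rightarrow> 'a \<Rightarrow> real" where
  "iterated_partial [] f = f"
| "iterated_partial (b # bs) f = (\<lambda>x. frechet_derivative (iterated_partial bs f) (at x) b)"

definition smooth :: "('a::euclidean_space \<Rightarrow> real) \<Rightarrow> bool" where
  "smooth f \<longleftrightarrow> (\<forall>bs. set bs \<subseteq> Basis \<longrightarrow> iterated_partial bs f differentiable_on UNIV)"

text \<open>
  Test functions are supported in the interior, so that the notions below may be applied to
  sets such as \<open>\<Omega> \<times> {0..T}\<close>, which differ from their interior by a null set.
\<close>

definition test_function :: "'a::euclidean_space set \<Rightarrow> ('a \<Rightarrow> real) \<Rightarrow> bool" where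
  "test_function U \<phi> \<longleftrightarrow> smooth \<phi> \<and> compact (closure {x. \<phi> x \<noteq> 0}) \<and>
                         closure {x. \<phi> x \<noteq> 0} \<subseteq> interior U"

text \<open>
  A multi-index of order at most \<open>k\<close> is a multiset of at most \<open>k\<close> basis vectors. The order in
  which the corresponding partial derivatives of a smooth function are taken is immaterial.
\<close>

definition multi_indices :: "nat \<Rightarrow> 'a::euclidean_space multiset set" where
  "multi_indices k = {\<alpha>. set_mset \<alpha> \<subseteq> Basis \<and> size \<alpha> \<le> k}"

lemma finite_multi_indices: "finite (multi_indices k :: 'a::euclidean_space multiset set)"
proof -
  have "multi_indices k \<subseteq> mset ` {bs :: 'a list. set bs \<subseteq> Basis \<and> length bs \<le> k}"
  proof
    fix \<alpha> :: "'a multiset"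
    assume "\<alpha> \<in> multi_indices k"
    moreover obtain bs where "mset bs = \<alpha>"
      using ex_mset by blast
    ultimately show "\<alpha> \<in> mset ` {bs. set bs \<subseteq> Basis \<and> length bs \<le> k}"
      by (auto simp: multi_indices_def)
  qed
  then show ?thesis
    by (rule finite_subset) (simp add: finite_lists_length_le)
qed

definition has_weak_derivative ::
  "'a::euclidean_space set \<Rightarrow> 'a multiset \<Rightarrow> ('a \<Rightarrow> 'b::euclidean_space) \<Rightarrow> ('a \<Rightarrow> 'b) \<Rightarrow> bool" where
  "has_weak_derivative U \<alpha> f g \<longleftrightarrow>
     (\<forall>\<phi> bs. test_function U \<phi> \<and> mset bs = \<alpha> \<longrightarrow>
        (LINT x|lebesgue_on U. iterated_partial bs \<phi> x *\<^sub>R f x) =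
        (-1) ^ size \<alpha> *\<^sub>R (LINT x|lebesgue_on U. \<phi> x *\<^sub>R g x))"

definition sobolev_space ::
  "'a::euclidean_space set \<Rightarrow> nat \<Rightarrow> ('a \<Rightarrow> 'b::euclidean_space) set" where
  "sobolev_space U k =
     {f \<in> L2 U. \<forall>\<alpha>\<in>multi_indices k. \<exists>g\<in>L2 U. has_weak_derivative U \<alpha> f g}"

text \<open>
  Weak derivatives are unique up to null sets, so the choice does not affect norms. For the
  empty multi-index the function itself is taken.
\<close>

definition weak_derivative ::
  "'a::euclidean_space set \<Rightarrow> 'a multiset \<Rightarrow> ('a \<Rightarrow> 'b::euclidean_space) \<Rightarrow> 'a \<Rightarrow> 'b" where
  "weak_derivative U \<alpha> f =
     (if \<alpha> = {#} then f else (SOME g. g \<in> L2 U \<and> has_weak_derivative U \<alpha> f g))"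

text \<open>This is the \<open>H\<^sup>k\<close> norm only for members of \<^term>\<open>sobolev_space U k\<close>.\<close>

definition sobolev_norm ::
  "'a::euclidean_space set \<Rightarrow> nat \<Rightarrow> ('a \<Rightarrow> 'b::euclidean_space) \<Rightarrow> real" where
  "sobolev_norm U k f = sqrt (\<Sum>\<alpha>\<in>multi_indices k. (L2_norm U (weak_derivative U \<alpha> f))\<^sup>2)"


section \<open>Function spaces and operators\<close>

definition function_space ::
  "'a::euclidean_space set \<Rightarrow> ('a \<Rightarrow> 'b::euclidean_space) set \<Rightarrow> bool" where
  "function_space U V \<longleftrightarrow> V \<subseteq> L2 U \<and> (\<lambda>_. 0) \<in> V \<and>
     (\<forall>v\<in>V. \<forall>w\<in>V. (\<lambda>x. v x + w x) \<in> V) \<and> (\<forall>c. \<forall>v\<in>V. (\<lambda>x. c *\<^sub>R v x) \<in> V)"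

definition linear_operator ::
  "'a::euclidean_space set \<Rightarrow> ('a \<Rightarrow> 'b::euclidean_space) set \<Rightarrow>
   (('a \<Rightarrow> 'b) \<Rightarrow> ('a \<Rightarrow> 'b)) \<Rightarrow> bool" where
  "linear_operator U V L \<longleftrightarrow>
     (\<forall>v\<in>V. L v \<in> V) \<and>
     (\<forall>v\<in>V. \<forall>w\<in>V. (AE x in lebesgue_on U. v x = w x) \<longrightarrow> (AE x in lebesgue_on U. L v x = L w x)) \<and>
     (\<forall>v\<in>V. \<forall>w\<in>V. AE x in lebesgue_on U. L (\<lambda>y. v y + w y) x = L v x + L w x) \<and>
     (\<forall>c. \<forall>v\<in>V. AE x in lebesgue_on U. L (\<lambda>y. c *\<^sub>R v y) x = c *\<^sub>R L v x)"


section \<open>Space-time domain and initial traces\<close>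

definition spacetime :: "'a::euclidean_space set \<Rightarrow> real \<Rightarrow> ('a \<times> real) set" where
  "spacetime \<Omega> T = \<Omega> \<times> {0..T}"

text \<open>
  An \<open>H\<^sup>1\<close> function on \<open>\<Omega> \<times> {0..T}\<close> is, after modification on a null set, a continuous
  function of \<open>t\<close> with values in \<open>L\<^sup>2(\<Omega>)\<close>, and its trace at \<open>t = 0\<close> is the value of that
  function at \<open>0\<close>. For an arbitrary representative, the trace is therefore the limit of the
  time slices in \<open>L\<^sup>2(\<Omega>)\<close> along almost every \<open>t\<close>.
\<close>

definition has_initial_trace ::
  "'a::euclidean_space set \<Rightarrow> real \<Rightarrow> ('a \<times> real \<Rightarrow> 'b::euclidean_space) \<Rightarrow> ('a \<Rightarrow> 'b) \<Rightarrow> bool" where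
  "has_initial_trace \<Omega> T v g \<longleftrightarrow>
     v \<in> sobolev_space (spacetime \<Omega> T) 1 \<and> g \<in> L2 \<Omega> \<and>
     (\<exists>N \<in> null_sets lebesgue.
        (\<forall>t \<in> {0<..<T} - N. (\<lambda>x. v (x, t)) \<in> L2 \<Omega>) \<and>
        ((\<lambda>t. L2_norm \<Omega> (\<lambda>x. v (x, t) - g x)) \<longlongrightarrow> 0) (at 0 within ({0<..<T} - N)))"

definition zero_trace_subspace ::
  "'a::euclidean_space set \<Rightarrow> real \<Rightarrow> ('a \<times> real \<Rightarrow> 'b::euclidean_space) set \<Rightarrow>
   ('a \<times> real \<Rightarrow> 'b) set" where
  "zero_trace_subspace \<Omega> T V = {v \<in> V. has_initial_trace \<Omega> T v (\<lambda>_. 0)}"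

definition initial_space ::
  "'a::euclidean_space set \<Rightarrow> real \<Rightarrow> ('a \<times> real \<Rightarrow> 'b::euclidean_space) set \<Rightarrow>
   ('a \<Rightarrow> 'b) set" where
  "initial_space \<Omega> T W = {g. \<exists>v\<in>W. has_initial_trace \<Omega> T v g}"


section \<open>Finite-element spaces\<close>

definition triangulation_of :: "'a::euclidean_space set \<Rightarrow> 'a set set \<Rightarrow> bool" where
  "triangulation_of U \<T> \<longleftrightarrow>
     triangulation \<T> \<and> (\<forall>K\<in>\<T>. int DIM('a) simplex K) \<and> \<Union>\<T> = closure U"

definition mesh_size :: "'a::euclidean_space set set \<Rightarrow> real" where
  "mesh_size \<T> = Max (diameter ` \<T>)"

definition finite_element_space ::
  "'a::euclidean_space set \<Rightarrow> 'a set set \<Rightarrow> ('a \<Rightarrow> 'b::euclidean_space) set \<Rightarrow> bool" where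
  "finite_element_space U \<T> W \<longleftrightarrow>
     function_space U W \<and>
     (\<exists>B. finite B \<and> B \<subseteq> W \<and>
        (\<forall>v\<in>W. \<exists>c. AE x in lebesgue_on U. v x = (\<Sum>b\<in>B. c b *\<^sub>R b x))) \<and>
     (\<forall>v\<in>W. \<forall>K\<in>\<T>. \<exists>q. polynomial_function q \<and> (AE x in lebesgue_on K. v x = q x))"


section \<open>First-order system least squares\<close>

definition initial_value_solution ::
  "'a::euclidean_space set \<Rightarrow> real \<Rightarrow> ('a \<times> real \<Rightarrow> 'b::euclidean_space) set \<Rightarrow>
   (('a \<times> real \<Rightarrow> 'b) \<Rightarrow> ('a \<times> real \<Rightarrow> 'b)) \<Rightarrow> ('a \<Rightarrow> 'b) \<Rightarrow> ('a \<times> real \<Rightarrow> 'b) \<Rightarrow> bool" where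
  "initial_value_solution \<Omega> T V L u0 u \<longleftrightarrow>
     u \<in> V \<and> (AE z in lebesgue_on (spacetime \<Omega> T). L u z = 0) \<and> has_initial_trace \<Omega> T u u0"

definition fosls_solution ::
  "'a::euclidean_space set \<Rightarrow> real \<Rightarrow> ('a \<times> real \<Rightarrow> 'b::euclidean_space) set \<Rightarrow>
   (('a \<times> real \<Rightarrow> 'b) \<Rightarrow> ('a \<times> real \<Rightarrow> 'b)) \<Rightarrow> ('a \<Rightarrow> 'b) \<Rightarrow> ('a \<times> real \<Rightarrow> 'b) \<Rightarrow> bool" where
  "fosls_solution \<Omega> T W L u0 uh \<longleftrightarrow>
     (\<exists>wh \<in> W. \<exists>\<phi>h \<in> zero_trace_subspace \<Omega> T W.
        has_initial_trace \<Omega> T wh u0 \<and>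
        uh = (\<lambda>z. wh z + \<phi>h z) \<and>
        (\<forall>vh \<in> zero_trace_subspace \<Omega> T W.
           L2_inner (spacetime \<Omega> T) (L \<phi>h) (L vh) = - L2_inner (spacetime \<Omega> T) (L wh) (L vh)))"

end

theory Submission
  imports Defs
begin

text \<open>
  Since \<open>L u = 0\<close>, the quantity to be bounded is \<open>\<langle>L u\<^sub>h, u\<^sub>h\<rangle>\<close>, which is at most
  \<open>\<parallel>L u\<^sub>h\<parallel> \<parallel>u\<^sub>h\<parallel>\<close>. Among the discrete functions \<open>v\<close> with initial trace \<open>u\<^sub>0\<close>, the solution
  \<open>u\<^sub>h\<close> minimises \<open>\<parallel>L v\<parallel> = \<parallel>L (u - v)\<parallel>\<close>, so \<open>\<parallel>L u\<^sub>h\<parallel>\<close> is bounded by the best approximation error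
  of \<open>u\<close> in the \<open>H\<^sup>1\<close> norm. Coercivity gives \<open>\<parallel>u\<^sub>h\<parallel> \<le> \<parallel>u\<parallel> + C \<parallel>L u\<^sub>h\<parallel>\<close>, which is bounded
  uniformly in \<open>h\<close>: a space-time domain that has a triangulation is bounded, and its diameter
  bounds every mesh size.
\<close>

section \<open>The pre-Hilbert structure of \<open>L2 U\<close>\<close>

lemma L2_borel_measurable: "f \<in> L2 U \<Longrightarrow> f \<in> borel_measurable (lebesgue_on U)"
  by (simp add: L2_def)

text \<open>The form \<open>f + c g\<close> covers sums (c = 1) and differences (c = -1) at once.
  Square-integrability rests on (a + b)^2 \<le> 2 a^2 + 2 b^2.\<close>

lemma L2_add_scaled:
  assumes f: "f \<in> L2 U" and g: "g \<in> L2 U"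
  shows "(\<lambda>x. f x + c *\<^sub>R g x) \<in> L2 U"
proof -
  note [measurable] = L2_borel_measurable[OF f] L2_borel_measurable[OF g]
  have "integrable (lebesgue_on U) (\<lambda>x. (norm (f x + c *\<^sub>R g x))\<^sup>2)"
  proof (rule Bochner_Integration.integrable_bound)
    show "integrable (lebesgue_on U) (\<lambda>x. 2 * (norm (f x))\<^sup>2 + 2 * c\<^sup>2 * (norm (g x))\<^sup>2)"
      using f g by (simp add: L2_def)
    have "(norm (f x + c *\<^sub>R g x))\<^sup>2 \<le> 2 * (norm (f x))\<^sup>2 + 2 * c\<^sup>2 * (norm (g x))\<^sup>2" for x
    proof -
      have "(norm (f x + c *\<^sub>R g x))\<^sup>2 \<le> (norm (f x) + \<bar>c\<bar> * norm (g x))\<^sup>2"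
        by (intro power_mono) (use norm_triangle_ineq[of "f x" "c *\<^sub>R g x"] in auto)
      also have "\<dots> \<le> 2 * (norm (f x))\<^sup>2 + 2 * (\<bar>c\<bar> * norm (g x))\<^sup>2"
        using sum_squares_bound[of "norm (f x)" "\<bar>c\<bar> * norm (g x)"]
        by (simp add: power2_sum)
      finally show ?thesis by (simp add: power_mult_distrib)
    qed
    then show "AE x in lebesgue_on U. norm ((norm (f x + c *\<^sub>R g x))\<^sup>2)
        \<le> norm (2 * (norm (f x))\<^sup>2 + 2 * c\<^sup>2 * (norm (g x))\<^sup>2)"
      by (auto intro: order_trans)
  qed measurable
  then show ?thesis by (simp add: L2_def)
qed

lemma L2_diff: "f \<in> L2 U \<Longrightarrow> g \<in> L2 U \<Longrightarrow> (\<lambda>x. f x - g x) \<in> L2 U"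
  using L2_add_scaled[of f U g "-1"] by simp

lemma L2_integrable_inner:
  assumes f: "f \<in> L2 U" and g: "g \<in> L2 U"
  shows "integrable (lebesgue_on U) (\<lambda>x. f x \<bullet> g x)"
proof (rule Bochner_Integration.integrable_bound)
  note [measurable] = L2_borel_measurable[OF f] L2_borel_measurable[OF g]
  show "integrable (lebesgue_on U) (\<lambda>x. (norm (f x))\<^sup>2 + (norm (g x))\<^sup>2)"
    using f g by (auto simp: L2_def)
  have "\<bar>f x \<bullet> g x\<bar> \<le> (norm (f x))\<^sup>2 + (norm (g x))\<^sup>2" for x
    using Cauchy_Schwarz_ineq2[of "f x" "g x"] sum_squares_bound[of "norm (f x)" "norm (g x)"]
      mult_nonneg_nonneg[OF norm_ge_zero[of "f x"] norm_ge_zero[of "g x"]]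
    by linarith
  then show "AE x in lebesgue_on U. norm (f x \<bullet> g x) \<le> norm ((norm (f x))\<^sup>2 + (norm (g x))\<^sup>2)"
    by simp
  show "(\<lambda>x. f x \<bullet> g x) \<in> borel_measurable (lebesgue_on U)"
    by measurable
qed

text \<open>Makes the pairing of a test function with an \<open>L2\<close> function integrable, so
  that such integrals split linearly.\<close>

lemma L2_integrable_scaleR:
  fixes \<phi> :: "'a::euclidean_space \<Rightarrow> real"
  assumes p: "\<phi> \<in> L2 U" and f: "f \<in> L2 U"
  shows "integrable (lebesgue_on U) (\<lambda>x. \<phi> x *\<^sub>R f x)"
proof (rule Bochner_Integration.integrable_bound)
  note [measurable] = L2_borel_measurable[OF p] L2_borel_measurable[OF f]
  show "integrable (lebesgue_on U) (\<lambda>x. (norm (\<phi> x))\<^sup>2 + (norm (f x))\<^sup>2)"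
    using p f by (auto simp: L2_def simp del: real_norm_def)
  have "norm (\<phi> x) * norm (f x) \<le> (norm (\<phi> x))\<^sup>2 + (norm (f x))\<^sup>2" for x
    using sum_squares_bound[of "norm (\<phi> x)" "norm (f x)"]
      mult_nonneg_nonneg[OF norm_ge_zero[of "\<phi> x"] norm_ge_zero[of "f x"]]
    by linarith
  then show "AE x in lebesgue_on U. norm (\<phi> x *\<^sub>R f x) \<le> norm ((norm (\<phi> x))\<^sup>2 + (norm (f x))\<^sup>2)"
    by simp
  show "(\<lambda>x. \<phi> x *\<^sub>R f x) \<in> borel_measurable (lebesgue_on U)"
    by measurable
qed

lemma L2_inner_commute: "L2_inner U f g = L2_inner U g f"
  by (simp add: L2_inner_def inner_commute)

lemma L2_inner_add_scaled:
  assumes "f \<in> L2 U" "g \<in> L2 U" "h \<in> L2 U"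
  shows "L2_inner U (\<lambda>x. f x + c *\<^sub>R g x) h = L2_inner U f h + c * L2_inner U g h"
  using L2_integrable_inner[OF assms(1,3)] L2_integrable_inner[OF assms(2,3)]
  by (simp add: L2_inner_def inner_add_left)

lemma L2_inner_nonneg: "0 \<le> L2_inner U f f"
  by (simp add: L2_inner_def)

lemma L2_norm_nonneg: "0 \<le> L2_norm U f"
  by (simp add: L2_norm_def L2_inner_nonneg)

lemma L2_norm_power2: "(L2_norm U f)\<^sup>2 = L2_inner U f f"
  by (simp add: L2_norm_def L2_inner_nonneg)

text \<open>Linearity of \<open>L\<close> and the equation \<open>L u = 0\<close> hold only almost
  everywhere, so every use of them under an inner product or a norm passes through this
  congruence.\<close>

lemma L2_inner_cong_AE:
  assumes "f \<in> L2 U" "f' \<in> L2 U" "g \<in> L2 U" "g' \<in> L2 U"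
    and "AE x in lebesgue_on U. f x = f' x" "AE x in lebesgue_on U. g x = g' x"
  shows "L2_inner U f g = L2_inner U f' g'"
  unfolding L2_inner_def
proof (rule integral_cong_AE)
  show "(\<lambda>x. f x \<bullet> g x) \<in> borel_measurable (lebesgue_on U)"
    by (rule borel_measurable_integrable[OF L2_integrable_inner[OF assms(1,3)]])
  show "(\<lambda>x. f' x \<bullet> g' x) \<in> borel_measurable (lebesgue_on U)"
    by (rule borel_measurable_integrable[OF L2_integrable_inner[OF assms(2,4)]])
  show "AE x in lebesgue_on U. f x \<bullet> g x = f' x \<bullet> g' x"
    using assms(5,6) by eventually_elim simp
qed

lemma L2_norm_cong_AE:
  assumes "f \<in> L2 U" "g \<in> L2 U" "AE x in lebesgue_on U. f x = g x"
  shows "L2_norm U f = L2_norm U g"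
  using L2_inner_cong_AE[of f U g f g] assms by (simp add: L2_norm_def)

lemma L2_norm_add_scaled_power2:
  assumes f: "f \<in> L2 U" and g: "g \<in> L2 U"
  shows "(L2_norm U (\<lambda>x. f x + c *\<^sub>R g x))\<^sup>2
    = (L2_norm U f)\<^sup>2 + 2 * c * L2_inner U f g + c\<^sup>2 * (L2_norm U g)\<^sup>2"
proof -
  let ?h = "\<lambda>x. f x + c *\<^sub>R g x"
  have "L2_inner U ?h ?h = L2_inner U f ?h + c * L2_inner U g ?h"
    by (rule L2_inner_add_scaled[OF f g L2_add_scaled[OF f g]])
  also have "\<dots> = L2_inner U ?h f + c * L2_inner U ?h g"
    by (simp only: L2_inner_commute)
  also have "\<dots> = L2_inner U f f + 2 * c * L2_inner U f g + c\<^sup>2 * L2_inner U g g"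
    using L2_inner_add_scaled[OF f g f, of c] L2_inner_add_scaled[OF f g g, of c]
      L2_inner_commute[of U g f] by (simp add: algebra_simps power2_eq_square)
  finally show ?thesis by (simp add: L2_norm_power2)
qed

text \<open>The discriminant argument: the squared norm of \<open>f + t g\<close> is a quadratic in
  t that is never negative.\<close>

lemma L2_Cauchy_Schwarz:
  assumes f: "f \<in> L2 U" and g: "g \<in> L2 U"
  shows "\<bar>L2_inner U f g\<bar> \<le> L2_norm U f * L2_norm U g"
proof -
  define a b c where "a = (L2_norm U f)\<^sup>2" and "b = L2_inner U f g" and "c = (L2_norm U g)\<^sup>2"
  have q: "0 \<le> a + 2 * t * b + t\<^sup>2 * c" for t
    using L2_norm_add_scaled_power2[OF f g, of t] by (metis a_def b_def c_def zero_le_power2)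
  have "b\<^sup>2 \<le> a * c"
  proof (cases "c = 0")
    case True
    have "b = 0"
    proof (rule ccontr)
      assume "b \<noteq> 0"
      then show False
        \<comment> \<open>With c = 0 the quadratic is the affine function a + 2 t b, which takes the
          value -1 at this t.\<close>
        using q[of "- (a + 1) / (2 * b)"] True by (simp add: field_simps)
    qed
    then show ?thesis using True by simp
  next
    case False
    then have "c > 0" by (simp add: c_def)
    then show ?thesis
      \<comment> \<open>This t is the minimiser; the value there is a - b^2 / c.\<close>
      using q[of "- b / c"] by (simp add: field_simps power2_eq_square)
  qed
  then have "\<bar>b\<bar>\<^sup>2 \<le> (L2_norm U f * L2_norm U g)\<^sup>2"
    by (simp add: a_def c_def power_mult_distrib)
  then show ?thesis
    unfolding b_def by (rule power2_le_imp_le) (simp add: L2_norm_nonneg)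
qed

lemma L2_norm_add_scaled_le:
  assumes f: "f \<in> L2 U" and g: "g \<in> L2 U"
  shows "L2_norm U (\<lambda>x. f x + c *\<^sub>R g x) \<le> L2_norm U f + \<bar>c\<bar> * L2_norm U g"
proof (rule power2_le_imp_le)
  have "c * L2_inner U f g \<le> \<bar>c\<bar> * (L2_norm U f * L2_norm U g)"
    using mult_left_mono[OF L2_Cauchy_Schwarz[OF f g] abs_ge_zero, of c]
    by (metis abs_le_D1 abs_mult)
  then show "(L2_norm U (\<lambda>x. f x + c *\<^sub>R g x))\<^sup>2 \<le> (L2_norm U f + \<bar>c\<bar> * L2_norm U g)\<^sup>2"
    unfolding L2_norm_add_scaled_power2[OF f g]
    by (simp add: power2_sum power_mult_distrib algebra_simps)
qed (simp add: L2_norm_nonneg)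

section \<open>Test functions, and linear combinations in Sobolev spaces\<close>

text \<open>The complement of \<open>K\<close> is open, so a function vanishing there agrees with 0
  near each of its points and its derivative is 0 too; induct on the list of directions.\<close>

lemma iterated_partial_eq_0_outside:
  assumes "closed K" and "\<And>x. x \<notin> K \<Longrightarrow> \<phi> x = 0" and "x \<notin> K"
  shows "iterated_partial bs \<phi> x = 0"
  using \<open>x \<notin> K\<close>
proof (induction bs arbitrary: x)
  case Nil
  then show ?case using assms by simp
next
  case (Cons b bs)
  have "((\<lambda>_. 0 :: real) has_derivative (\<lambda>_. 0)) (at x)" by (rule has_derivative_const)
  then have "(iterated_partial bs \<phi> has_derivative (\<lambda>_. 0)) (at x)"
  proof (rule has_derivative_transform_within_open[where s = "- K"])
    show "open (- K)" using assms(1) by (rule open_Compl)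
    show "x \<in> - K" using Cons.prems by simp
    show "0 = iterated_partial bs \<phi> y" if "y \<in> - K" for y
      using Cons.IH[of y] that by simp
  qed
  then have "frechet_derivative (iterated_partial bs \<phi>) (at x) = (\<lambda>_. 0)"
    by (rule frechet_derivative_at[symmetric])
  then show ?case by simp
qed

text \<open>Smoothness makes each iterated partial continuous, and it vanishes off the compact
  support of \<phi>, so its square is integrable over the whole space and hence over
  \<open>U\<close>.\<close>

lemma iterated_partial_L2:
  assumes "test_function U \<phi>" and "U \<in> sets lebesgue" and "set bs \<subseteq> Basis"
  shows "iterated_partial bs \<phi> \<in> L2 U"
proof -
  let ?K = "closure {x. \<phi> x \<noteq> 0}" and ?f = "iterated_partial bs \<phi>"
  have cont: "continuous_on UNIV ?f"
    using assms(1,3) by (auto simp: test_function_def smooth_def intro: differentiable_imp_continuous_on)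
  have zero: "?f x = 0" if "x \<notin> ?K" for x
    by (rule iterated_partial_eq_0_outside[OF _ _ that]) (use closure_subset[of "{x. \<phi> x \<noteq> 0}"] in auto)
  have "integrable lborel (\<lambda>x. indicator ?K x *\<^sub>R (norm (?f x))\<^sup>2)"
    using assms(1) cont
    by (intro borel_integrable_compact continuous_intros continuous_on_subset[OF cont])
      (auto simp: test_function_def)
  also have "(\<lambda>x. indicator ?K x *\<^sub>R (norm (?f x))\<^sup>2) = (\<lambda>x. (norm (?f x))\<^sup>2)"
  proof
    show "indicator ?K x *\<^sub>R (norm (?f x))\<^sup>2 = (norm (?f x))\<^sup>2" for x
      by (cases "x \<in> ?K") (simp_all add: zero)
  qed
  \<comment> \<open>Continuity gives integrability for the Borel measure; it carries over to the
    completion.\<close>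
  finally have "integrable lebesgue (\<lambda>x. (norm (?f x))\<^sup>2)"
    by (simp add: integrable_completion borel_measurable_integrable)
  then have "integrable (lebesgue_on U) (\<lambda>x. (norm (?f x))\<^sup>2)"
    using assms(2) by (simp add: integrable_restrict_space integrable_mult_indicator 
        del: real_scaleR_def)
  moreover have "?f \<in> borel_measurable (lebesgue_on U)"
    using borel_measurable_continuous_onI[OF cont]
    by (simp add: measurable_completion measurable_restrict_space1)
  ultimately show ?thesis by (simp add: L2_def)
qed

text \<open>Both sides of the integration-by-parts identity are linear in the function and its
  derivative, once all the products involved are integrable.\<close>

lemma has_weak_derivative_add_scaled:
  assumes "U \<in> sets lebesgue" and "set_mset \<alpha> \<subseteq> Basis"
    and "f \<in> L2 U" "f' \<in> L2 U" "g \<in> L2 U" "g' \<in> L2 U"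
    and "has_weak_derivative U \<alpha> f f'" "has_weak_derivative U \<alpha> g g'"
  shows "has_weak_derivative U \<alpha> (\<lambda>x. f x + c *\<^sub>R g x) (\<lambda>x. f' x + c *\<^sub>R g' x)"
  unfolding has_weak_derivative_def
proof (intro allI impI; elim conjE)
  fix \<phi> bs
  assume \<phi>: "test_function U \<phi>" and bs: "mset bs = \<alpha>"
  \<comment> \<open>Used twice: with \<psi> the iterated partial paired with \<open>f\<close>,
    \<open>g\<close>, and with \<psi> = \<phi> paired with \<open>f'\<close>,
    \<open>g'\<close>.\<close>
  have lin: "(LINT x|lebesgue_on U. \<psi> x *\<^sub>R (h x + c *\<^sub>R k x))
      = (LINT x|lebesgue_on U. \<psi> x *\<^sub>R h x) + c *\<^sub>R (LINT x|lebesgue_on U. \<psi> x *\<^sub>R k x)"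
    if "\<psi> \<in> L2 U" "h \<in> L2 U" "k \<in> L2 U" for \<psi> :: "'a \<Rightarrow> real" and h k :: "'a \<Rightarrow> 'b"
  proof -
    have "(LINT x|lebesgue_on U. \<psi> x *\<^sub>R (h x + c *\<^sub>R k x))
        = (LINT x|lebesgue_on U. \<psi> x *\<^sub>R h x + c *\<^sub>R (\<psi> x *\<^sub>R k x))"
      by (simp add: scaleR_add_right mult.commute)
    then show ?thesis
      using L2_integrable_scaleR[OF that(1,2)] L2_integrable_scaleR[OF that(1,3)]
      by (simp del: scaleR_scaleR)
  qed
  have "iterated_partial bs \<phi> \<in> L2 U" "\<phi> \<in> L2 U"
    \<comment> \<open>The empty list of directions yields \<phi> itself.\<close>
    using iterated_partial_L2[OF \<phi> assms(1), of bs] iterated_partial_L2[OF \<phi> assms(1), of "[]"]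
      assms(2) bs by auto
  then show "(LINT x|lebesgue_on U. iterated_partial bs \<phi> x *\<^sub>R (f x + c *\<^sub>R g x)) =
      (- 1) ^ size \<alpha> *\<^sub>R (LINT x|lebesgue_on U. \<phi> x *\<^sub>R (f' x + c *\<^sub>R g' x))"
    using assms \<phi> bs unfolding has_weak_derivative_def
    by (simp only: lin) (simp add: scaleR_add_right mult.commute)
qed

lemma sobolev_space_add_scaled:
  assumes U: "U \<in> sets lebesgue" and f: "f \<in> sobolev_space U k" and g: "g \<in> sobolev_space U k"
  shows "(\<lambda>x. f x + c *\<^sub>R g x) \<in> sobolev_space U k"
proof -
  have "\<exists>h\<in>L2 U. has_weak_derivative U \<alpha> (\<lambda>x. f x + c *\<^sub>R g x) h"
    if \<alpha>: "\<alpha> \<in> multi_indices k" for \<alpha>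
  proof -
    obtain f' g' where "f' \<in> L2 U" "g' \<in> L2 U"
      "has_weak_derivative U \<alpha> f f'" "has_weak_derivative U \<alpha> g g'"
      using f g \<alpha> unfolding sobolev_space_def by blast
    then have "has_weak_derivative U \<alpha> (\<lambda>x. f x + c *\<^sub>R g x) (\<lambda>x. f' x + c *\<^sub>R g' x)"
      using f g \<alpha> by (intro has_weak_derivative_add_scaled[OF U])
        (auto simp: sobolev_space_def multi_indices_def)
    then show ?thesis using L2_add_scaled[OF \<open>f' \<in> L2 U\<close> \<open>g' \<in> L2 U\<close>] by blast
  qed
  then show ?thesis
    using f g by (auto simp: sobolev_space_def intro: L2_add_scaled)
qed

text \<open>The summand at the empty multi-index is the squared \<open>L2\<close> norm of
  \<open>f\<close>, because \<open>weak_derivative\<close> returns \<open>f\<close> itself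
  there.\<close>

lemma L2_norm_le_sobolev_norm: "L2_norm U f \<le> sobolev_norm U k f"
proof -
  have "{#} \<in> multi_indices k" by (simp add: multi_indices_def)
  then have "(L2_norm U (weak_derivative U {#} f))\<^sup>2
      \<le> (\<Sum>\<alpha>\<in>multi_indices k. (L2_norm U (weak_derivative U \<alpha> f))\<^sup>2)"
    by (intro member_le_sum) (auto simp: finite_multi_indices)
  then show ?thesis
    unfolding sobolev_norm_def by (intro real_le_rsqrt) (simp add: weak_derivative_def)
qed

lemma sobolev_norm_nonneg: "0 \<le> sobolev_norm U k f"
  by (simp add: sobolev_norm_def sum_nonneg)

section \<open>Linearity of the initial trace\<close>

text \<open>Slice by slice, the distance to the combined trace is at most the corresponding
  combination of the two distances, both of which tend to 0. The exceptional null sets of times are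
  united.\<close>

lemma has_initial_trace_add_scaled:
  assumes U: "spacetime \<Omega> T \<in> sets lebesgue"
    and v: "has_initial_trace \<Omega> T v g" and w: "has_initial_trace \<Omega> T w h"
  shows "has_initial_trace \<Omega> T (\<lambda>z. v z + c *\<^sub>R w z) (\<lambda>x. g x + c *\<^sub>R h x)"
proof -
  have g: "g \<in> L2 \<Omega>" and h: "h \<in> L2 \<Omega>"
    using v w by (auto simp: has_initial_trace_def)
  obtain M where M: "M \<in> null_sets lebesgue" "\<And>t. t \<in> {0<..<T} - M \<Longrightarrow> (\<lambda>x. v (x, t)) \<in> L2 \<Omega>"
    "((\<lambda>t. L2_norm \<Omega> (\<lambda>x. v (x, t) - g x)) \<longlongrightarrow> 0) (at 0 within ({0<..<T} - M))"
    using v unfolding has_initial_trace_def by blast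
  obtain N where N: "N \<in> null_sets lebesgue" "\<And>t. t \<in> {0<..<T} - N \<Longrightarrow> (\<lambda>x. w (x, t)) \<in> L2 \<Omega>"
    "((\<lambda>t. L2_norm \<Omega> (\<lambda>x. w (x, t) - h x)) \<longlongrightarrow> 0) (at 0 within ({0<..<T} - N))"
    using w unfolding has_initial_trace_def by blast
  let ?S = "{0<..<T} - (M \<union> N)"
  \<comment> \<open>Both limits survive restriction to the smaller common set of times.\<close>
  have "((\<lambda>t. L2_norm \<Omega> (\<lambda>x. v (x, t) - g x)) \<longlongrightarrow> 0) (at 0 within ?S)"
    "((\<lambda>t. L2_norm \<Omega> (\<lambda>x. w (x, t) - h x)) \<longlongrightarrow> 0) (at 0 within ?S)"
    by (rule tendsto_within_subset[OF M(3)], blast) (rule tendsto_within_subset[OF N(3)], blast)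
  then have bound: "((\<lambda>t. L2_norm \<Omega> (\<lambda>x. v (x, t) - g x) + \<bar>c\<bar> * L2_norm \<Omega> (\<lambda>x. w (x, t) - h x))
      \<longlongrightarrow> 0) (at 0 within ?S)"
    by (auto intro!: tendsto_eq_intros)
  have le: "L2_norm \<Omega> (\<lambda>x. v (x, t) + c *\<^sub>R w (x, t) - (g x + c *\<^sub>R h x))
      \<le> L2_norm \<Omega> (\<lambda>x. v (x, t) - g x) + \<bar>c\<bar> * L2_norm \<Omega> (\<lambda>x. w (x, t) - h x)"
    if "t \<in> ?S" for t
  proof -
    have "(\<lambda>x. v (x, t) + c *\<^sub>R w (x, t) - (g x + c *\<^sub>R h x))
        = (\<lambda>x. (v (x, t) - g x) + c *\<^sub>R (w (x, t) - h x))"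
      by (simp add: algebra_simps)
    then show ?thesis
      using that M(2)[of t] N(2)[of t] g h by (simp add: L2_norm_add_scaled_le L2_diff)
  qed
  have "((\<lambda>t. L2_norm \<Omega> (\<lambda>x. v (x, t) + c *\<^sub>R w (x, t) - (g x + c *\<^sub>R h x))) \<longlongrightarrow> 0) (at 0 within ?S)"
    by (rule tendsto_sandwich[OF _ _ tendsto_const bound])
      (auto simp: eventually_at_filter L2_norm_nonneg le)
  moreover have "M \<union> N \<in> null_sets lebesgue"
    using M(1) N(1) by (rule null_sets.Un)
  moreover have "\<forall>t\<in>?S. (\<lambda>x. v (x, t) + c *\<^sub>R w (x, t)) \<in> L2 \<Omega>"
    using M(2) N(2) by (auto intro: L2_add_scaled)
  ultimately show ?thesis
    using v w g h U unfolding has_initial_trace_def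
    by (auto intro: sobolev_space_add_scaled L2_add_scaled)
qed

lemma has_initial_trace_add_zero:
  assumes "spacetime \<Omega> T \<in> sets lebesgue" "has_initial_trace \<Omega> T v g"
    and "has_initial_trace \<Omega> T w (\<lambda>_. 0)"
  shows "has_initial_trace \<Omega> T (\<lambda>z. v z + w z) g"
  using has_initial_trace_add_scaled[OF assms, of 1] by simp

text \<open>Places the difference of two functions with the same initial data where coercivity and
  the discrete orthogonality relation apply.\<close>

lemma has_initial_trace_diff_same:
  assumes "spacetime \<Omega> T \<in> sets lebesgue" "has_initial_trace \<Omega> T v g" "has_initial_trace \<Omega> T w g"
  shows "has_initial_trace \<Omega> T (\<lambda>z. v z - w z) (\<lambda>_. 0)"
  using has_initial_trace_add_scaled[OF assms, of "-1"] by simp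

section \<open>Algebra of function spaces and operators\<close>

lemma function_space_L2: "function_space U V \<Longrightarrow> v \<in> V \<Longrightarrow> v \<in> L2 U"
  by (auto simp: function_space_def)

lemma function_space_add:
  "function_space U V \<Longrightarrow> v \<in> V \<Longrightarrow> w \<in> V \<Longrightarrow> (\<lambda>x. v x + w x) \<in> V"
  by (auto simp: function_space_def)

lemma function_space_scaleR:
  "function_space U V \<Longrightarrow> v \<in> V \<Longrightarrow> (\<lambda>x. c *\<^sub>R v x) \<in> V"
  by (auto simp: function_space_def)

lemma function_space_diff:
  assumes "function_space U V" "v \<in> V" "w \<in> V"
  shows "(\<lambda>x. v x - w x) \<in> V"
  using function_space_add[OF assms(1,2) function_space_scaleR[OF assms(1,3), of "-1"]] by simp

lemma linear_operator_in: "linear_operator U V L \<Longrightarrow> v \<in> V \<Longrightarrow> L v \<in> V"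
  by (auto simp: linear_operator_def)

lemma linear_operator_add:
  "linear_operator U V L \<Longrightarrow> v \<in> V \<Longrightarrow> w \<in> V
    \<Longrightarrow> AE x in lebesgue_on U. L (\<lambda>y. v y + w y) x = L v x + L w x"
  by (auto simp: linear_operator_def)

lemma linear_operator_scaleR:
  "linear_operator U V L \<Longrightarrow> v \<in> V
    \<Longrightarrow> AE x in lebesgue_on U. L (\<lambda>y. c *\<^sub>R v y) x = c *\<^sub>R L v x"
  by (auto simp: linear_operator_def)

lemma linear_operator_diff:
  assumes "function_space U V" "linear_operator U V L" "v \<in> V" "w \<in> V"
  shows "AE x in lebesgue_on U. L (\<lambda>y. v y - w y) x = L v x - L w x"
proof -
  have m: "(\<lambda>y. (-1) *\<^sub>R w y) \<in> V"
    by (rule function_space_scaleR[OF assms(1,4)])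
  have "AE x in lebesgue_on U. L (\<lambda>y. v y + (-1) *\<^sub>R w y) x = L v x + L (\<lambda>y. (-1) *\<^sub>R w y) x"
    by (rule linear_operator_add[OF assms(2,3) m])
  moreover have "AE x in lebesgue_on U. L (\<lambda>y. (-1) *\<^sub>R w y) x = (-1) *\<^sub>R L w x"
    by (rule linear_operator_scaleR[OF assms(2,4)])
  ultimately show ?thesis by eventually_elim simp
qed

section \<open>Orthogonality and minimality of the FOSLS solution\<close>

lemma fosls_solution_in:
  assumes "spacetime \<Omega> T \<in> sets lebesgue" "function_space (spacetime \<Omega> T) W"
    and "fosls_solution \<Omega> T W L u0 uh"
  shows "uh \<in> W" "has_initial_trace \<Omega> T uh u0"
proof -
  obtain wh \<phi> where "wh \<in> W" "\<phi> \<in> W" "has_initial_trace \<Omega> T wh u0"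
    "has_initial_trace \<Omega> T \<phi> (\<lambda>_. 0)" "uh = (\<lambda>z. wh z + \<phi> z)"
    using assms(3) unfolding fosls_solution_def zero_trace_subspace_def by blast
  then show "uh \<in> W" "has_initial_trace \<Omega> T uh u0"
    using function_space_add[OF assms(2)] has_initial_trace_add_zero[OF assms(1)] by blast+
qed

text \<open>The variational equation with both terms on one side, joined by
  \<open>L (wh + \<phi>) = L wh + L \<phi>\<close> almost everywhere.\<close>

lemma fosls_solution_orthogonal:
  assumes V: "function_space (spacetime \<Omega> T) V" "linear_operator (spacetime \<Omega> T) V L" and "W \<subseteq> V"
    and uh: "fosls_solution \<Omega> T W L u0 uh" and v: "v \<in> zero_trace_subspace \<Omega> T W"
  shows "L2_inner (spacetime \<Omega> T) (L uh) (L v) = 0"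
proof -
  let ?U = "spacetime \<Omega> T"
  obtain wh \<phi> where wh: "wh \<in> W" and \<phi>: "\<phi> \<in> W" and uh: "uh = (\<lambda>z. wh z + \<phi> z)"
    and eq: "L2_inner ?U (L \<phi>) (L v) = - L2_inner ?U (L wh) (L v)"
    using uh v unfolding fosls_solution_def zero_trace_subspace_def by blast
  have in_V: "wh \<in> V" "\<phi> \<in> V" "v \<in> V"
    using wh \<phi> v \<open>W \<subseteq> V\<close> by (auto simp: zero_trace_subspace_def)
  have L2: "L w \<in> L2 ?U" if "w \<in> V" for w
    by (intro function_space_L2[OF V(1)] linear_operator_in[OF V(2)] that)
  have "L2_inner ?U (L uh) (L v) = L2_inner ?U (\<lambda>z. L wh z + 1 *\<^sub>R L \<phi> z) (L v)"
    using in_V linear_operator_add[OF V(2), of wh \<phi>] unfolding uh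
    by (intro L2_inner_cong_AE L2_add_scaled L2 function_space_add[OF V(1)]) auto
  also have "\<dots> = L2_inner ?U (L wh) (L v) + 1 * L2_inner ?U (L \<phi>) (L v)"
    using in_V by (intro L2_inner_add_scaled L2)
  finally show ?thesis by (simp add: eq)
qed

text \<open>Pythagoras: \<open>L v\<close> is \<open>L uh\<close> plus \<open>L\<close> of the
  difference \<open>v - uh\<close>, which has zero trace and so contributes orthogonally.\<close>

lemma fosls_solution_minimal:
  assumes U: "spacetime \<Omega> T \<in> sets lebesgue"
    and V: "function_space (spacetime \<Omega> T) V" "linear_operator (spacetime \<Omega> T) V L"
    and W: "function_space (spacetime \<Omega> T) W" "W \<subseteq> V"
    and uh: "fosls_solution \<Omega> T W L u0 uh" and v: "v \<in> W" "has_initial_trace \<Omega> T v u0"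
  shows "L2_norm (spacetime \<Omega> T) (L uh) \<le> L2_norm (spacetime \<Omega> T) (L v)"
proof -
  let ?U = "spacetime \<Omega> T" and ?e = "\<lambda>z. v z - uh z"
  have uh_in: "uh \<in> W" "has_initial_trace \<Omega> T uh u0"
    using fosls_solution_in[OF U W(1) uh] .
  have e: "?e \<in> zero_trace_subspace \<Omega> T W"
    using v uh_in by (simp add: zero_trace_subspace_def function_space_diff[OF W(1)]
        has_initial_trace_diff_same[OF U])
  have in_V: "v \<in> V" "uh \<in> V" "?e \<in> V"
    using v uh_in e W(2) by (auto simp: zero_trace_subspace_def)
  have L2: "L w \<in> L2 ?U" if "w \<in> V" for w
    by (intro function_space_L2[OF V(1)] linear_operator_in[OF V(2)] that)
  \<comment> \<open>The factor 1 gives the sum the shape expected by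
    \<open>L2_norm_add_scaled_power2\<close>.\<close>
  have "L2_norm ?U (L v) = L2_norm ?U (\<lambda>z. L uh z + 1 *\<^sub>R L ?e z)"
    using in_V linear_operator_diff[OF V, of v uh]
    by (intro L2_norm_cong_AE L2_add_scaled L2) auto
  then have "(L2_norm ?U (L v))\<^sup>2 = (L2_norm ?U (L uh))\<^sup>2 + (L2_norm ?U (L ?e))\<^sup>2"
    using L2_norm_add_scaled_power2[OF L2[OF in_V(2)] L2[OF in_V(3)], of 1]
      fosls_solution_orthogonal[OF V W(2) uh e] by simp
  then show ?thesis
    by - (rule power2_le_imp_le[OF _ L2_norm_nonneg], simp)
qed

section \<open>Geometry of the mesh and the domain\<close>

text \<open>The closure of \<open>U\<close> is a finite union of simplices, each of them
  compact.\<close>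

lemma triangulation_of_bounded:
  assumes "triangulation_of U \<T>"
  shows "bounded U"
proof -
  have "bounded (\<Union>\<T>)"
    using assms unfolding triangulation_of_def triangulation_def
    by (intro bounded_Union ballI) (auto dest: compact_simplex intro: compact_imp_bounded)
  then have "bounded (closure U)"
    using assms by (simp add: triangulation_of_def)
  then show ?thesis
    using bounded_subset closure_subset by blast
qed

text \<open>The maximum is attained by a cell inside the closure of \<open>U\<close>, which has the
  same diameter as \<open>U\<close>. The upper bound is what makes the final constant independent of
  the mesh.\<close>

lemma mesh_size_bounds:
  assumes "triangulation_of U \<T>" "U \<noteq> {}"
  shows "0 \<le> mesh_size \<T>" "mesh_size \<T> \<le> diameter U"
proof -
  have bd: "bounded (closure U)"
    using triangulation_of_bounded[OF assms(1)] by (rule bounded_closure)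
  have fin: "finite \<T>" and un: "\<Union>\<T> = closure U"
    using assms(1) by (auto simp: triangulation_of_def triangulation_def)
  then have "\<T> \<noteq> {}" using assms(2) by (metis Union_empty closure_eq_empty)
  then have "mesh_size \<T> \<in> diameter ` \<T>"
    unfolding mesh_size_def using fin by (intro Max_in) auto
  then obtain K where "K \<in> \<T>" "mesh_size \<T> = diameter K" by auto
  moreover have "K \<subseteq> closure U" using \<open>K \<in> \<T>\<close> un by auto
  ultimately show "0 \<le> mesh_size \<T>" "mesh_size \<T> \<le> diameter U"
    using bd diameter_ge_0[of K] diameter_subset[of K "closure U"]
      diameter_closure[of U] triangulation_of_bounded[OF assms(1)]
    by (auto intro: bounded_subset)
qed

lemma spacetime_lebesgue: "open \<Omega> \<Longrightarrow> spacetime \<Omega> T \<in> sets lebesgue"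
proof -
  assume "open \<Omega>"
  then have "\<Omega> \<times> {0..T} \<in> sets borel"
    by (intro borel_Times) auto
  then show ?thesis by (simp add: spacetime_def)
qed

section \<open>The error estimate\<close>

theorem theorem2:
  fixes \<Omega> :: "'a::euclidean_space set"
    and T :: real
    and V :: "('a \<times> real \<Rightarrow> 'b::euclidean_space) set"
    and L :: "('a \<times> real \<Rightarrow> 'b) \<Rightarrow> ('a \<times> real \<Rightarrow> 'b)"
    and \<T> :: "'i \<Rightarrow> ('a \<times> real) set set"
    and Vh :: "'i \<Rightarrow> ('a \<times> real \<Rightarrow> 'b) set"
    and u0 :: "'a \<Rightarrow> 'b"
    and u :: "'a \<times> real \<Rightarrow> 'b"
    and p :: nat
  assumes domain: "open \<Omega>" "connected \<Omega>" "\<Omega> \<noteq> {}" "T > 0"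
    and space: "function_space (spacetime \<Omega> T) V"
    and operator: "linear_operator (spacetime \<Omega> T) V L"
    and upper: "\<exists>C. \<forall>v \<in> V \<inter> sobolev_space (spacetime \<Omega> T) 1.
                  L2_norm (spacetime \<Omega> T) (L v) \<le> C * sobolev_norm (spacetime \<Omega> T) 1 v"
    and lower: "\<exists>C. \<forall>v \<in> zero_trace_subspace \<Omega> T V.
                  sobolev_norm (spacetime \<Omega> T) 1 v \<le> C * L2_norm (spacetime \<Omega> T) (L v)"
    and mesh: "\<And>i. triangulation_of (spacetime \<Omega> T) (\<T> i)"
    and fe_space: "\<And>i. finite_element_space (spacetime \<Omega> T) (\<T> i) (Vh i)" "\<And>i. Vh i \<subseteq> V"
    and initial: "\<And>i. u0 \<in> initial_space \<Omega> T (Vh i)"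
    and solution: "initial_value_solution \<Omega> T V L u0 u"
    and regular: "u \<in> sobolev_space (spacetime \<Omega> T) (p + 1)"
    and order_p: "\<exists>C. \<forall>i.
           Inf {sobolev_norm (spacetime \<Omega> T) 1 (\<lambda>z. u z - v z) | v.
                  v \<in> Vh i \<and> has_initial_trace \<Omega> T v u0}
             \<le> C * mesh_size (\<T> i) ^ p * sobolev_norm (spacetime \<Omega> T) (p + 1) u"
  shows "\<exists>C. \<forall>i uh. fosls_solution \<Omega> T (Vh i) L u0 uh \<longrightarrow>
           \<bar>L2_inner (spacetime \<Omega> T) (L u) u - L2_inner (spacetime \<Omega> T) (L uh) uh\<bar>
             \<le> C * mesh_size (\<T> i) ^ p * sobolev_norm (spacetime \<Omega> T) (p + 1) u"
proof -
  let ?U = "spacetime \<Omega> T" and ?S = "sobolev_norm (spacetime \<Omega> T) (p + 1) u"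
  have U: "?U \<in> sets lebesgue" by (rule spacetime_lebesgue[OF domain(1)])
  have U_ne: "?U \<noteq> {}" using domain by (auto simp: spacetime_def)
  \<comment> \<open>The constant is enlarged to be positive because it is divided by below.\<close>
  obtain C1 where C1: "C1 > 0" "\<And>v. v \<in> V \<Longrightarrow> v \<in> sobolev_space ?U 1 \<Longrightarrow>
      L2_norm ?U (L v) \<le> C1 * sobolev_norm ?U 1 v"
  proof -
    obtain C where C: "\<forall>v \<in> V \<inter> sobolev_space ?U 1. L2_norm ?U (L v) \<le> C * sobolev_norm ?U 1 v"
      using upper by blast
    show ?thesis
    proof (rule that[of "max C 1"])
      fix v assume "v \<in> V" "v \<in> sobolev_space ?U 1"
      then have "L2_norm ?U (L v) \<le> C * sobolev_norm ?U 1 v" using C by blast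
      also have "\<dots> \<le> max C 1 * sobolev_norm ?U 1 v"
        by (intro mult_right_mono) (auto simp: sobolev_norm_nonneg)
      finally show "L2_norm ?U (L v) \<le> max C 1 * sobolev_norm ?U 1 v" .
    qed simp
  qed
  obtain C2 where C2: "C2 \<ge> 0" "\<And>v. v \<in> zero_trace_subspace \<Omega> T V \<Longrightarrow>
      sobolev_norm ?U 1 v \<le> C2 * L2_norm ?U (L v)"
  proof -
    obtain C where C: "\<forall>v \<in> zero_trace_subspace \<Omega> T V. sobolev_norm ?U 1 v \<le> C * L2_norm ?U (L v)"
      using lower by blast
    show ?thesis
    proof (rule that[of "max C 0"])
      fix v assume "v \<in> zero_trace_subspace \<Omega> T V"
      then have "sobolev_norm ?U 1 v \<le> C * L2_norm ?U (L v)" using C by blast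
      also have "\<dots> \<le> max C 0 * L2_norm ?U (L v)"
        by (intro mult_right_mono) (auto simp: L2_norm_nonneg)
      finally show "sobolev_norm ?U 1 v \<le> max C 0 * L2_norm ?U (L v)" .
    qed simp
  qed
  obtain C3 where C3: "\<And>i. Inf {sobolev_norm ?U 1 (\<lambda>z. u z - v z) | v.
      v \<in> Vh i \<and> has_initial_trace \<Omega> T v u0} \<le> C3 * mesh_size (\<T> i) ^ p * ?S"
    using order_p by blast
  have u: "u \<in> V" "AE z in lebesgue_on ?U. L u z = 0" "has_initial_trace \<Omega> T u u0"
    using solution by (auto simp: initial_value_solution_def)
  have W: "function_space ?U (Vh i)" for i
    using fe_space(1) by (auto simp: finite_element_space_def)
  have L2: "L w \<in> L2 ?U" if "w \<in> V" for w
    by (intro function_space_L2[OF space] linear_operator_in[OF operator] that)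
  \<comment> \<open>Since \<open>L u = 0\<close>, the function \<open>L (u - v)\<close> equals
    \<open>- L v\<close> almost everywhere. The residual of \<open>v\<close> thus measures its
    error.\<close>
  have L_diff: "L2_norm ?U (L (\<lambda>z. u z - v z)) = L2_norm ?U (L v)" if "v \<in> V" for v
  proof -
    have "L2_norm ?U (L (\<lambda>z. u z - v z)) = L2_norm ?U (\<lambda>z. L u z - L v z)"
      using u that linear_operator_diff[OF space operator]
      by (intro L2_norm_cong_AE L2 L2_diff function_space_diff[OF space]) auto
    also have "\<dots> = L2_norm ?U (\<lambda>z. 0 - L v z)"
      using u that function_space_def space
      by (intro L2_norm_cong_AE L2_diff L2) (auto simp: L2_def)
    also have "\<dots> = L2_norm ?U (L v)"
      by (simp add: L2_norm_def L2_inner_def)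
    finally show ?thesis .
  qed
  have Lu: "L2_inner ?U (L u) u = 0"
  proof -
    have "L2_inner ?U (L u) u = L2_inner ?U (\<lambda>_. 0) u"
      using u(1,2) L2[OF u(1)] function_space_L2[OF space u(1)]
      by (intro L2_inner_cong_AE) (auto simp: L2_def)
    then show ?thesis by (simp add: L2_inner_def)
  qed
  \<comment> \<open>\<open>M\<close> will bound the norm of \<open>L uh\<close> and \<open>B\<close>
    that of \<open>uh\<close>, both uniformly in the mesh: the mesh size is replaced by the diameter
    of the domain, and \<open>C3\<close>, whose sign is unknown, by its absolute value.\<close>
  define M where "M = C1 * \<bar>C3\<bar> * diameter ?U ^ p * ?S"
  define B where "B = L2_norm ?U u + C2 * M"
  show ?thesis
  proof (intro exI allI impI)
    fix i uh
    assume uh: "fosls_solution \<Omega> T (Vh i) L u0 uh"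
    let ?N = "L2_norm ?U (L uh)" and ?h = "mesh_size (\<T> i)"
    have uh_in: "uh \<in> Vh i" "has_initial_trace \<Omega> T uh u0"
      using fosls_solution_in[OF U W uh] .
    then have uhV: "uh \<in> V" using fe_space(2) by blast
    \<comment> \<open>Bounding the infimum from below avoids choosing a nearly optimal approximant.
      The set is nonempty because \<open>uh\<close> itself is a competitor.\<close>
    have "?N / C1 \<le> Inf {sobolev_norm ?U 1 (\<lambda>z. u z - v z) | v.
        v \<in> Vh i \<and> has_initial_trace \<Omega> T v u0}"
    proof (rule cInf_greatest)
      show "{sobolev_norm ?U 1 (\<lambda>z. u z - v z) | v. v \<in> Vh i \<and> has_initial_trace \<Omega> T v u0} \<noteq> {}"
        using uh_in by blast
      fix s assume "s \<in> {sobolev_norm ?U 1 (\<lambda>z. u z - v z) | v.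
          v \<in> Vh i \<and> has_initial_trace \<Omega> T v u0}"
      then obtain v where s: "s = sobolev_norm ?U 1 (\<lambda>z. u z - v z)"
        and v: "v \<in> Vh i" "has_initial_trace \<Omega> T v u0" by blast
      have vV: "v \<in> V" using v fe_space(2) by blast
      have "?N \<le> L2_norm ?U (L v)"
        by (rule fosls_solution_minimal[OF U space operator W fe_space(2) uh v])
      also have "\<dots> = L2_norm ?U (L (\<lambda>z. u z - v z))"
        by (simp add: L_diff vV)
      also have "\<dots> \<le> C1 * s"
        unfolding s using has_initial_trace_diff_same[OF U u(3) v(2)] 
        by (intro C1(2) function_space_diff[OF space u(1) vV]) (simp add: has_initial_trace_def)
      finally show "?N / C1 \<le> s" using C1(1) by (simp add: field_simps)
    qed
    then have "?N / C1 \<le> C3 * ?h ^ p * ?S" using C3[of i] by linarith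
    then have N: "?N \<le> C1 * C3 * ?h ^ p * ?S"
      using C1(1) by (simp add: field_simps)
    have h: "0 \<le> ?h" "?h \<le> diameter ?U"
      using mesh_size_bounds[OF mesh U_ne] by auto
    note N
    also have "C1 * C3 * ?h ^ p * ?S \<le> C1 * \<bar>C3\<bar> * ?h ^ p * ?S"
      using C1(1) h
      by (intro mult_right_mono mult_left_mono) (auto simp: sobolev_norm_nonneg)
    also have "\<dots> \<le> M"
      unfolding M_def using C1(1) h
      by (intro mult_right_mono mult_mono power_mono) (auto simp: sobolev_norm_nonneg)
    finally have NM: "?N \<le> M" .
    \<comment> \<open>The function \<open>uh\<close> is written as u - (u - uh); coercivity then
      controls the zero-trace difference by its residual, which by \<open>L_diff\<close> has norm
      \<open>?N\<close>.\<close>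
    have "L2_norm ?U uh = L2_norm ?U (\<lambda>z. u z + (-1) *\<^sub>R (u z - uh z))" by simp
    also have "\<dots> \<le> L2_norm ?U u + \<bar>-1\<bar> * L2_norm ?U (\<lambda>z. u z - uh z)"
      using u uhV by (intro L2_norm_add_scaled_le L2_diff function_space_L2[OF space])
    also have "L2_norm ?U (\<lambda>z. u z - uh z) \<le> sobolev_norm ?U 1 (\<lambda>z. u z - uh z)"
      by (rule L2_norm_le_sobolev_norm)
    also have "\<dots> \<le> C2 * ?N"
      using C2(2)[of "\<lambda>z. u z - uh z"] u uhV uh_in
      by (simp add: L_diff zero_trace_subspace_def function_space_diff[OF space]
          has_initial_trace_diff_same[OF U])
    also have "\<dots> \<le> C2 * M" using NM C2(1) by (rule mult_left_mono)
    finally have uh_B: "L2_norm ?U uh \<le> B" by (simp add: B_def)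
    have "\<bar>L2_inner ?U (L u) u - L2_inner ?U (L uh) uh\<bar> \<le> ?N * L2_norm ?U uh"
      using L2_Cauchy_Schwarz[OF L2[OF uhV] function_space_L2[OF space uhV]] by (simp add: Lu)
    also have "\<dots> \<le> ?N * B" using uh_B by (intro mult_left_mono) (auto simp: L2_norm_nonneg)
    \<comment> \<open>The sharp bound \<open>N\<close>, still carrying the power of the mesh size,
      enters here. Multiplying by \<open>B\<close> is monotone since \<open>B\<close> dominates a
      norm and so is nonnegative.\<close>
    also have "\<dots> \<le> (C1 * C3 * ?h ^ p * ?S) * B"
      using N uh_B L2_norm_nonneg[of ?U uh] by (intro mult_right_mono) auto
    also have "\<dots> = (B * C1 * C3) * ?h ^ p * ?S" by simp
    finally show "\<bar>L2_inner ?U (L u) u - L2_inner ?U (L uh) uh\<bar> \<le> (B * C1 * C3) * ?h ^ p * ?S" .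
  qed
qed

end
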